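(* Let $n\ge 1$, let $\theta_1,\dots,\theta_n>0$ be pairwise distinct, and let $S_n\sim\mathrm{HypoXG}(\theta_1,\dots,\theta_n)$. Then the reliability function of $S_n$ satisfies $$R_{S_n}(t)=\sum_{i=1}^{n}\sum_{k=1}^{3}R_{ik}\,R_{Y_{ik}}(t),$$ where $R_{Y_{ik}}(t)$ is the reliability function of $Y_{ik}\sim\mathrm{Erl}(4-k,\theta_i)$ and the $R_{ik}$ are the HypoXG coefficients associated with $(\theta_1,\dots,\theta_n)$.
   Context: The reliability function of a real random variable $X$ with cumulative distribution function $F_X$ is $R_X(t)=1-F_X(t)$ (not to be confused with the real coefficients $R_{ik}$). XGamma distribution: for $\theta>0$, $X\sim \mathrm{XG}(\theta)$ means $X$ is a real random variable with density $\frac{\theta^2}{1+\theta}\left(1+\frac{\theta}{2}t^2\right)e^{-\theta t}$ for $t>0$, and $0$ otherwise. HypoXG: $S_n\sim\mathrm{HypoXG}(\theta_1,\dots,\theta_n)$ means $S_n=X_1+\cdots+X_n$ with $X_1,\dots,X_n$ independent and $X_j\sim\mathrm{XG}(\theta_j)$. Erlang distribution: for an integer $m\ge 1$ and $\theta>0$, $Y\sim\mathrm{Erl}(m,\theta)$ means $Y$ has density $\frac{(\theta t)^{m-1}\theta e^{-\theta t}}{(m-1)!}$ for $t\ge 0$ and $0$ for $t<0$. HypoXG coefficients: for pairwise distinct $\theta_1,\dots,\theta_n>0$, $1\le i\le n$, $1\le k\le 3$, $$R_{ik}=\frac{A_{ik}}{\theta_i^{4-k}}\prod_{l=1}^{n}\frac{\theta_l^{2}}{1+\theta_l},$$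 where $$A_{i1}=\theta_i\prod_{j\ne i}\frac{(\theta_j-\theta_i)^2+\theta_j}{(\theta_j-\theta_i)^3},\qquad A_{i2}=A_{i1}\sum_{j\neq i}\left(\frac{2(\theta_j-\theta_i)}{(\theta_j-\theta_i)^2+\theta_j}-\frac{3}{\theta_j-\theta_i}\right),$$ $$A_{i3}=\frac{A_{i1}}{2}\left(\sum_{j\ne i}\left(\frac{2(\theta_j-\theta_i)}{(\theta_j-\theta_i)^2+\theta_j}-\frac{3}{\theta_j-\theta_i}\right)\right)^{2}+\frac{A_{i1}}{2}\left(\frac{2}{\theta_i}+\sum_{j\ne i}\left(-2\,\frac{(\theta_j-\theta_i)^2-\theta_j}{\left((\theta_j-\theta_i)^2+\theta_j\right)^2}+\frac{3}{(\theta_j-\theta_i)^2}\right)\right),$$ products and sums being over $j\in\{1,\dots,n\}\setminus\{i\}$ (empty product $=1$, empty sum $=0$). *)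

theory Defs
  imports "HOL-Probability.Probability"
begin

definition reliability :: "'a measure \<Rightarrow> ('a \<Rightarrow> real) \<Rightarrow> real \<Rightarrow> real" where
  "reliability M X t = 1 - cdf (distr M borel X) t"

definition xgamma_density :: "real \<Rightarrow> real \<Rightarrow> real" where
  "xgamma_density \<theta> t =
     (if t > 0 then \<theta>\<^sup>2 / (1 + \<theta>) * (1 + \<theta> / 2 * t\<^sup>2) * exp (- \<theta> * t) else 0)"

definition xgamma_rv :: "'a measure \<Rightarrow> real \<Rightarrow> ('a \<Rightarrow> real) \<Rightarrow> bool" where
  "xgamma_rv M \<theta> X \<longleftrightarrow>
     prob_space M \<and> \<theta> > 0 \<and> distributed M lborel X (\<lambda>t. ennreal (xgamma_density \<theta> t))"

text \<open>The parameters are \<open>\<theta> 1, \<dots>, \<theta> n\<close>; values of \<open>\<theta>\<close> outside \<open>{1..n}\<close> are irrelevant.\<close>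

definition hypoxg_rv :: "'a measure \<Rightarrow> nat \<Rightarrow> (nat \<Rightarrow> real) \<Rightarrow> ('a \<Rightarrow> real) \<Rightarrow> bool" where
  "hypoxg_rv M n \<theta> S \<longleftrightarrow>
     prob_space M \<and>
     (\<exists>X :: nat \<Rightarrow> 'a \<Rightarrow> real.
        prob_space.indep_vars M (\<lambda>_. borel) X {1..n} \<and>
        (\<forall>j\<in>{1..n}. xgamma_rv M (\<theta> j) (X j)) \<and>
        (\<forall>\<omega>\<in>space M. S \<omega> = (\<Sum>j=1..n. X j \<omega>)))"

text \<open>The shape parameter of \<open>erlang_density\<close> is shifted: \<open>erlang_density k \<theta>\<close> has
  \<open>t ^ k / fact k\<close>, so the Erlang law with shape \<open>m\<close> uses \<open>k = m - 1\<close>.\<close>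

definition erlang_rv :: "'a measure \<Rightarrow> nat \<Rightarrow> real \<Rightarrow> ('a \<Rightarrow> real) \<Rightarrow> bool" where
  "erlang_rv M m \<theta> Y \<longleftrightarrow>
     prob_space M \<and> m \<ge> 1 \<and> \<theta> > 0 \<and>
     distributed M lborel Y (\<lambda>t. ennreal (erlang_density (m - 1) \<theta> t))"

definition hypoxg_A1 :: "nat \<Rightarrow> (nat \<Rightarrow> real) \<Rightarrow> nat \<Rightarrow> real" where
  "hypoxg_A1 n \<theta> i =
     \<theta> i * (\<Prod>j\<in>{1..n} - {i}. ((\<theta> j - \<theta> i)\<^sup>2 + \<theta> j) / (\<theta> j - \<theta> i) ^ 3)"

definition hypoxg_A2 :: "nat \<Rightarrow> (nat \<Rightarrow> real) \<Rightarrow> nat \<Rightarrow> real" where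
  "hypoxg_A2 n \<theta> i =
     hypoxg_A1 n \<theta> i *
     (\<Sum>j\<in>{1..n} - {i}. 2 * (\<theta> j - \<theta> i) / ((\<theta> j - \<theta> i)\<^sup>2 + \<theta> j) - 3 / (\<theta> j - \<theta> i))"

definition hypoxg_A3 :: "nat \<Rightarrow> (nat \<Rightarrow> real) \<Rightarrow> nat \<Rightarrow> real" where
  "hypoxg_A3 n \<theta> i =
     hypoxg_A1 n \<theta> i / 2 *
     (\<Sum>j\<in>{1..n} - {i}.
        2 * (\<theta> j - \<theta> i) / ((\<theta> j - \<theta> i)\<^sup>2 + \<theta> j) - 3 / (\<theta> j - \<theta> i))\<^sup>2
   + hypoxg_A1 n \<theta> i / 2 *
     (2 / \<theta> i +
      (\<Sum>j\<in>{1..n} - {i}.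
         - 2 * (((\<theta> j - \<theta> i)\<^sup>2 - \<theta> j) / ((\<theta> j - \<theta> i)\<^sup>2 + \<theta> j)\<^sup>2)
         + 3 / (\<theta> j - \<theta> i)\<^sup>2))"

text \<open>Only \<open>k \<in> {1, 2, 3}\<close> is meaningful; the final branch is the case \<open>k = 3\<close>.\<close>

definition hypoxg_A :: "nat \<Rightarrow> (nat \<Rightarrow> real) \<Rightarrow> nat \<Rightarrow> nat \<Rightarrow> real" where
  "hypoxg_A n \<theta> i k =
     (if k = 1 then hypoxg_A1 n \<theta> i
      else if k = 2 then hypoxg_A2 n \<theta> i
      else hypoxg_A3 n \<theta> i)"

definition hypoxg_R :: "nat \<Rightarrow> (nat \<Rightarrow> real) \<Rightarrow> nat \<Rightarrow> nat \<Rightarrow> real" where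
  "hypoxg_R n \<theta> i k =
     hypoxg_A n \<theta> i k / \<theta> i ^ (4 - k) * (\<Prod>l=1..n. (\<theta> l)\<^sup>2 / (1 + \<theta> l))"

end

theory Submission
  imports Defs
begin

text \<open>
  With \<open>s = -it\<close>, the characteristic function of \<open>XG(\<theta>)\<close> at \<open>t\<close> is
  \<open>\<theta>\<^sup>2/(1+\<theta>) \<cdot> ((s+\<theta>)\<^sup>2+\<theta>)/(s+\<theta>)\<^sup>3\<close> and that of \<open>Erl(m,\<theta>)\<close> is \<open>(\<theta>/(s+\<theta>))\<^sup>m\<close>. By
  independence the characteristic function of \<open>S\<^sub>n\<close> is a rational function of \<open>s\<close> with triple poles
  at \<open>-\<theta>\<^sub>i\<close>; the \<open>A\<^sub>i\<^sub>k\<close> are the Taylor coefficients at \<open>-\<theta>\<^sub>i\<close> of this function times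
  \<open>(s+\<theta>\<^sub>i)\<^sup>3\<close>, up to the factor \<open>\<Prod>\<^sub>l \<theta>\<^sub>l\<^sup>2/(1+\<theta>\<^sub>l)\<close>, so partial fractions express it as a signed mixture of Erlang characteristic
  functions. Levy's inversion formula is linear in the characteristic function and hence carries the
  identity over to the distribution functions.
\<close>

section \<open>Levy inversion for signed mixtures of distributions\<close>

text \<open>Away from 0 the kernel is bounded by \<open>b - a\<close> and the characteristic
  function by 1, so the integrand is bounded almost everywhere on a bounded interval. This licenses
  splitting the inversion integral over a finite sum.\<close>

lemma (in real_distribution) Levy_kernel_integrable:
  fixes a b T :: real
  assumes "a \<le> b"
  shows "interval_lebesgue_integrable lborel (- ereal T) (ereal T)
           (\<lambda>t. (iexp (-(t * a)) - iexp (-(t * b))) / (\<i> * t) * char M t)"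
proof -
  have bound: "cmod ((iexp (-(t * a)) - iexp (-(t * b))) / (\<i> * t) * char M t) \<le> b - a"
    if "t \<noteq> 0" for t
    using mult_mono[OF Levy_Inversion_aux2[of "-b" "-a" t] cmod_char_le_1[of t]] assms that
    by (simp only: norm_mult) simp
  \<comment> \<open>The endpoints stay arbitrary because the sign of \<open>T\<close> is not fixed
    and interval integrability distinguishes the two orders.\<close>
  have "set_integrable lborel (einterval (ereal u) (ereal v))
      (\<lambda>t. (iexp (-(t * a)) - iexp (-(t * b))) / (\<i> * t) * char M t)" for u v :: real
    unfolding set_integrable_def
  proof (rule integrableI_bounded_set_indicator)
    show "emeasure lborel (einterval (ereal u) (ereal v)) < \<infinity>"
      by (cases "u \<le> v") auto
    show "AE t in lborel. t \<in> einterval (ereal u) (ereal v) \<longrightarrow>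
        cmod ((iexp (-(t * a)) - iexp (-(t * b))) / (\<i> * t) * char M t) \<le> b - a"
      using AE_lborel_singleton[of "0::real"] by eventually_elim (use bound in blast)
  qed measurable
  then show ?thesis
    by (simp add: interval_lebesgue_integrable_def)
qed

text \<open>The \<open>c i\<close> may be negative, so the right-hand side is not known in advance
  to be a distribution function, and uniqueness for characteristic functions does not apply
  directly. Levy inversion is linear, so the difference \<open>D\<close> of the two sides takes a
  single value off the countable set of atoms. Its limit at minus infinity makes that value 0, and
  right-continuity extends this to every point.\<close>

lemma cdf_signed_mixture:
  fixes M :: "real measure" and N :: "'i \<Rightarrow> real measure" and c :: "'i \<Rightarrow> real"
  assumes fin: "finite I" and "real_distribution M"
    and N: "\<And>i. i \<in> I \<Longrightarrow> real_distribution (N i)"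
    and char_eq: "\<And>t. char M t = (\<Sum>i\<in>I. c i * char (N i) t)"
  shows "cdf M x = (\<Sum>i\<in>I. c i * cdf (N i) x)"
proof -
  interpret M: real_distribution M by fact
  \<comment> \<open>The inversion formula requires endpoints that are not atoms of the law at hand.
    \<open>A\<close> collects the atoms of all the laws involved; it is countable, so its complement
    is dense.\<close>
  define A where "A = {y. measure M {y} \<noteq> 0} \<union> (\<Union>i\<in>I. {y. measure (N i) {y} \<noteq> 0})"
  have count: "countable A"
    unfolding A_def using fin
    by (intro countable_Un countable_UN M.countable_support countable_finite[OF fin])
      (auto intro!: finite_measure.countable_support prob_space.finite_measure real_distribution.axioms(1) N)
  define D where "D y = cdf M y - (\<Sum>i\<in>I. c i * cdf (N i) y)" for y
  have D_eq: "D a = D b" if ab: "a < b" "a \<notin> A" "b \<notin> A" for a b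
  proof -
    let ?F = "\<lambda>t::real. (iexp (-(t * a)) - iexp (-(t * b))) / (\<i> * t)"
    let ?L = "\<lambda>N T. 1 / (2 * pi) * (CLBINT t=-ereal (real T)..ereal (real T). ?F t * char N t)"
    have "a \<le> b" using \<open>a < b\<close> by simp
    have L: "?L M T = (\<Sum>i\<in>I. c i * ?L (N i) T)" for T
    proof -
      have int: "integrable lborel (\<lambda>t.
          indicator (einterval (-ereal (real T)) (ereal (real T))) t *\<^sub>R (?F t * char (N i) t))"
        if "i \<in> I" for i
        using real_distribution.Levy_kernel_integrable[OF N[OF that] \<open>a \<le> b\<close>, of "real T"]
        by (simp add: interval_lebesgue_integrable_def set_integrable_def)
      have "(CLBINT t=-ereal (real T)..ereal (real T). ?F t * char M t) =
          (CLBINT t. (\<Sum>i\<in>I. c i *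
            (indicator (einterval (-ereal (real T)) (ereal (real T))) t *\<^sub>R (?F t * char (N i) t))))"
        unfolding interval_lebesgue_integral_def set_lebesgue_integral_def
        by (auto intro!: Bochner_Integration.integral_cong
            simp: char_eq sum_distrib_left sum_distrib_right sum_divide_distrib
              scaleR_conv_of_real ac_simps)
      also have "\<dots> = (\<Sum>i\<in>I. c i * (CLBINT t=-ereal (real T)..ereal (real T). ?F t * char (N i) t))"
        by (subst Bochner_Integration.integral_sum, intro integrable_mult_right int)
          (simp_all only: interval_lebesgue_integral_def set_lebesgue_integral_def integral_mult_right_zero, simp)
      finally show ?thesis by (simp add: sum_distrib_left ac_simps)
    qed
    have "(\<lambda>T. ?L M T) \<longlonglongrightarrow> measure M {a<..b}"
      using M.Levy_Inversion[OF \<open>a \<le> b\<close>] ab by (simp add: A_def)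
    moreover have "(\<lambda>T. ?L (N i) T) \<longlonglongrightarrow> measure (N i) {a<..b}" if "i \<in> I" for i
      using real_distribution.Levy_Inversion[OF N[OF that] \<open>a \<le> b\<close>] ab that by (simp add: A_def)
    then have "(\<lambda>T. ?L M T) \<longlonglongrightarrow> (\<Sum>i\<in>I. c i * complex_of_real (measure (N i) {a<..b}))"
      unfolding L by (intro tendsto_sum tendsto_mult tendsto_const)
    ultimately have "complex_of_real (measure M {a<..b}) =
        (\<Sum>i\<in>I. c i * complex_of_real (measure (N i) {a<..b}))"
      by (rule LIMSEQ_unique)
    then have "measure M {a<..b} = (\<Sum>i\<in>I. c i * measure (N i) {a<..b})"
      by (simp flip: of_real_mult of_real_sum)
    also have "\<dots> = (\<Sum>i\<in>I. c i * (cdf (N i) b - cdf (N i) a))"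
      using \<open>a < b\<close> N
      by (simp add: finite_borel_measure.cdf_diff_eq real_distribution.finite_borel_measure_M)
    finally show ?thesis
      using \<open>a < b\<close> by (simp add: D_def M.cdf_diff_eq[symmetric] right_diff_distrib sum_subtractf)
  qed
  have D_bot: "(D \<longlongrightarrow> 0) at_bot"
    unfolding D_def using N
    by (auto intro!: tendsto_eq_intros M.cdf_lim_at_bot tendsto_sum
        finite_borel_measure.cdf_lim_at_bot real_distribution.finite_borel_measure_M)
  have D_right: "(D \<longlongrightarrow> D x) (at_right x)"
    unfolding D_def using N M.cdf_is_right_cont
    by (auto intro!: tendsto_intros simp: continuous_within
       finite_borel_measure.cdf_is_right_cont[unfolded continuous_within] real_distribution.finite_borel_measure_M)
  \<comment> \<open>Far enough to the left, \<open>D\<close> is smaller in absolute value than a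
    nonzero \<open>D y\<close>, yet there are points outside \<open>A\<close> there, at which
    \<open>D\<close> equals \<open>D y\<close>.\<close>
  have D_0: "D y = 0" if "y \<notin> A" for y
  proof (rule ccontr)
    assume "D y \<noteq> 0"
    then have "eventually (\<lambda>z. dist (D z) 0 < \<bar>D y\<bar> \<and> z < y) at_bot"
      using tendstoD[OF D_bot, of "\<bar>D y\<bar>"] by (auto intro: eventually_conj eventually_gt_at_bot)
    then obtain u where u: "\<And>z. z \<le> u \<Longrightarrow> \<bar>D z\<bar> < \<bar>D y\<bar> \<and> z < y"
      unfolding eventually_at_bot_linorder by auto
    obtain z where "z < u" "z \<notin> A"
      using open_minus_countable[OF count, of "{..<u}"] by auto
    with u[of z] D_eq[of z y] that show False by auto
  qed
  have "D x = 0"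
  proof (rule ccontr)
    assume "D x \<noteq> 0"
    then have "eventually (\<lambda>z. dist (D z) (D x) < \<bar>D x\<bar>) (at_right x)"
      using tendstoD[OF D_right, of "\<bar>D x\<bar>"] by auto
    then obtain v where "x < v" and v: "\<And>z. x < z \<Longrightarrow> z < v \<Longrightarrow> dist (D z) (D x) < \<bar>D x\<bar>"
      by (auto simp: eventually_at_right[OF less_add_one])
    obtain z where "x < z" "z < v" "z \<notin> A"
      using open_minus_countable[OF count, of "{x<..<v}"] \<open>x < v\<close> by auto
    with v[of z] D_0[of z] show False by (simp add: dist_real_def)
  qed
  then show ?thesis by (simp add: D_def)
qed

section \<open>Characteristic functions of the Erlang and XGamma laws\<close>

text \<open>In norm the integrand is at most a constant multiple of the Erlang density with rate
  \<open>Re z\<close>, whose zeroth moment is finite.\<close>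

lemma integrable_power_exp_complex:
  fixes z :: complex
  assumes "Re z > 0"
  shows "integrable lborel (\<lambda>x::real. indicator {0<..} x *\<^sub>R (of_real x ^ k * exp (- z * of_real x)))"
proof -
  have "integrable lborel (\<lambda>x. erlang_density k (Re z) x * x ^ 0)"
    using nn_integral_erlang_ith_moment[OF assms, of k 0] assms
    by (intro integrableI_nonneg) auto
  then have "integrable lborel (\<lambda>x. fact k / Re z ^ Suc k * erlang_density k (Re z) x)"
    by simp
  then show ?thesis
    by (rule Bochner_Integration.integrable_bound)
      (use assms in \<open>auto simp: erlang_density_def norm_mult norm_power split: split_indicator\<close>)
qed

text \<open>This is the Laplace transform of a power at a complex argument. Integration by parts
  gives the recursion \<open>?I k = k / z * ?I (k - 1)\<close> for positive \<open>k\<close>, and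
  induction does the rest.\<close>

lemma integral_power_exp_complex:
  fixes z :: complex
  assumes z: "Re z > 0"
  shows "(CLBINT x. indicator {0<..} x *\<^sub>R (of_real x ^ k * exp (- z * of_real x))) = fact k / z ^ Suc k"
proof -
  let ?f = "\<lambda>k x. of_real x ^ k * exp (- z * of_real x) :: complex"
  let ?I = "\<lambda>k. CLBINT x. indicator {0<..} x *\<^sub>R ?f k x"
  have "z \<noteq> 0" using z by auto
  have lim: "((\<lambda>x::real. ?f k x) \<longlongrightarrow> 0) at_top" for k
  proof (rule tendsto_norm_zero_cancel)
    have "((\<lambda>x. (Re z * x) ^ k / exp (Re z * x)) \<longlongrightarrow> 0) at_top"
      using z by (intro filterlim_compose[OF tendsto_power_div_exp_0]
          filterlim_tendsto_pos_mult_at_top[OF tendsto_const] filterlim_ident)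
    from tendsto_mult[OF tendsto_const[of "inverse (Re z ^ k)"] this]
    have "((\<lambda>x. x ^ k * exp (- (Re z * x))) \<longlongrightarrow> 0) at_top"
      using z by (simp add: power_mult_distrib exp_minus field_simps)
    moreover have "eventually (\<lambda>x::real. x ^ k * exp (- (Re z * x)) = norm (?f k x)) at_top"
      using eventually_ge_at_top[of 0] by eventually_elim (simp add: norm_mult norm_power)
    ultimately show "((\<lambda>x::real. norm (?f k x)) \<longlongrightarrow> 0) at_top"
      by (rule Lim_transform_eventually)
  qed
  \<comment> \<open>One identity covers both the base case and the recursion. For
    \<open>k = 0\<close> the truncated \<open>k - 1\<close> is harmless, since its coefficient
    vanishes. The term \<open>0 ^ k / z\<close> comes from the boundary at 0 and is nonzero only for
    \<open>k = 0\<close>.\<close>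
  have step: "?I k - of_nat k / z * ?I (k - 1) = 0 ^ k / z" for k
  proof -
    define F where "F x = - (?f k x / z)" for x :: real
    define g where "g x = ?f k x - of_nat k / z * ?f (k - 1) x" for x :: real
    have int: "integrable lborel (\<lambda>x. indicator {0<..} x *\<^sub>R ?f k x)" for k
      using integrable_power_exp_complex[OF z] .
    have "(CLBINT x=ereal 0..\<infinity>. g x) = 0 - (- (0 ^ k / z))"
    proof (rule interval_integral_FTC_integrable)
      show "(F has_vector_derivative g x) (at x)" for x
        unfolding F_def g_def using \<open>z \<noteq> 0\<close>
        by (auto intro!: derivative_eq_intros has_vector_derivative_real_field simp: field_simps)
      show "isCont g x" for x
        unfolding g_def by (intro continuous_intros)
      have "integrable lborel (\<lambda>x. indicator {0<..} x *\<^sub>R ?f k x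
          - of_nat k / z * (indicator {0<..} x *\<^sub>R ?f (k - 1) x))"
        by (intro Bochner_Integration.integrable_diff integrable_mult_right int)
      also have "(\<lambda>x. indicator {0<..} x *\<^sub>R ?f k x - of_nat k / z * (indicator {0<..} x *\<^sub>R ?f (k - 1) x))
          = (\<lambda>x. indicator {0<..} x *\<^sub>R g x)"
        by (auto simp: g_def split: split_indicator)
      finally show "set_integrable lborel (einterval (ereal 0) \<infinity>) g"
        by (simp add: set_integrable_def)
      have "isCont F 0"
        unfolding F_def using \<open>z \<noteq> 0\<close> by (intro continuous_intros) auto
      then have "(F \<longlongrightarrow> F 0) (at_right 0)"
        by (simp add: isCont_def filterlim_at_split)
      then show "((F \<circ> real_of_ereal) \<longlongrightarrow> - (0 ^ k / z)) (at_right (ereal 0))"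
        by (simp add: ereal_tendsto_simps F_def)
      have "(F \<longlongrightarrow> - (0 / z)) at_top"
        unfolding F_def using \<open>z \<noteq> 0\<close> by (intro tendsto_intros lim)
      then show "((F \<circ> real_of_ereal) \<longlongrightarrow> 0) (at_left \<infinity>)"
        by (simp add: ereal_tendsto_simps)
    qed simp
    moreover have "(CLBINT x=ereal 0..\<infinity>. g x)
        = (CLBINT x. indicator {0<..} x *\<^sub>R ?f k x - of_nat k / z * (indicator {0<..} x *\<^sub>R ?f (k - 1) x))"
      by (auto simp: interval_integral_to_infinity_eq set_lebesgue_integral_def g_def
          intro!: Bochner_Integration.integral_cong split: split_indicator)
    moreover have "\<dots> = ?I k - of_nat k / z * ?I (k - 1)"
      by (simp only: Bochner_Integration.integral_diff[OF int integrable_mult_right[OF int]]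
          integral_mult_right_zero)
    ultimately show ?thesis by simp
  qed
  show ?thesis
  proof (induction k)
    case 0
    show ?case using step[of 0] by simp
  next
    case (Suc k)
    have "?I (Suc k) = of_nat (Suc k) / z * ?I k"
      using step[of "Suc k"] by simp
    then show ?case
      unfolding Suc.IH by (simp add: field_simps)
  qed
qed

lemma char_density:
  assumes [measurable]: "f \<in> borel_measurable borel" and "\<And>x. 0 \<le> f x"
  shows "char (density lborel (\<lambda>x. ennreal (f x))) t = (CLBINT x. f x *\<^sub>R iexp (t * x))"
  unfolding char_def using assms by (intro integral_density) auto

lemma iexp_mult_exp:
  "exp (- l * x) *\<^sub>R iexp (t * x) = exp (- (complex_of_real l - \<i> * t) * of_real x)" for l x t :: real
  by (simp add: scaleR_conv_of_real exp_of_real[symmetric] exp_add[symmetric] algebra_simps)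

lemma char_erlang_density:
  assumes l: "l > 0"
  shows "char (density lborel (\<lambda>x. ennreal (erlang_density k l x))) t
    = complex_of_real l ^ Suc k / (l - \<i> * t) ^ Suc k"
proof -
  let ?z = "complex_of_real l - \<i> * t"
  have "char (density lborel (\<lambda>x. ennreal (erlang_density k l x))) t
      = (CLBINT x. erlang_density k l x *\<^sub>R iexp (t * x))"
    using l by (intro char_density) auto
  also have "\<dots> = (CLBINT x. (l ^ Suc k / fact k) *\<^sub>R
      (indicator {0<..} x *\<^sub>R (of_real x ^ k * exp (- ?z * of_real x))))"
  \<comment> \<open>For \<open>k = 0\<close> the Erlang density is nonzero at the point 0, which the
    indicator excludes, so the integrands agree only almost everywhere.\<close>
  proof (rule integral_cong_AE)
    have "erlang_density k l x *\<^sub>R iexp (t * x) = (l ^ Suc k / fact k) *\<^sub>R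
      (indicator {0<..} x *\<^sub>R (of_real x ^ k * exp (- ?z * of_real x)))" if "x \<noteq> 0" for x
      unfolding iexp_mult_exp[symmetric] using that
      by (auto simp: erlang_density_def scaleR_conv_of_real split: split_indicator)
    then show "AE x in lborel. erlang_density k l x *\<^sub>R iexp (t * x) = (l ^ Suc k / fact k) *\<^sub>R
      (indicator {0<..} x *\<^sub>R (of_real x ^ k * exp (- ?z * of_real x)))"
      using AE_lborel_singleton[of "0::real"] by (auto elim: eventually_mono)
  qed measurable
  also have "\<dots> = (l ^ Suc k / fact k) *\<^sub>R (fact k / ?z ^ Suc k)"
    using l by (subst integral_scaleR_right, subst integral_power_exp_complex) simp_all
  also have "\<dots> = complex_of_real l ^ Suc k / (l - \<i> * t) ^ Suc k"
    by (simp add: scaleR_conv_of_real)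
  finally show ?thesis .
qed

text \<open>Up to its normalising factor the density is an exponential times 1 plus
  \<open>l / 2\<close> times the square. The two parts transform into \<open>1 / z\<close> and
  \<open>l / z ^ 3\<close> at \<open>z = l - it\<close>; a common denominator gives the quotient.
  \<open>w t\<close> is written in the form in which the partial fractions are later
  evaluated.\<close>

lemma char_xgamma_density:
  assumes l: "l > 0"
  defines "w \<equiv> \<lambda>t. - \<i> * complex_of_real t + l"
  shows "char (density lborel (\<lambda>x. ennreal (xgamma_density l x))) t
    = complex_of_real (l\<^sup>2 / (1 + l)) * (((w t)\<^sup>2 + l) / (w t) ^ 3)"
proof -
  let ?z = "complex_of_real l - \<i> * t"
  let ?f = "\<lambda>k x. indicator {0<..} x *\<^sub>R (of_real x ^ k * exp (- ?z * of_real x))"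
  have "Re ?z > 0" using l by simp
  then have "?z \<noteq> 0" by (metis less_irrefl zero_complex.sel(1))
  note int = integrable_power_exp_complex[OF \<open>Re ?z > 0\<close>]
  have [measurable]: "xgamma_density l \<in> borel_measurable borel"
    unfolding xgamma_density_def[abs_def] by measurable
  have "char (density lborel (\<lambda>x. ennreal (xgamma_density l x))) t
      = (CLBINT x. xgamma_density l x *\<^sub>R iexp (t * x))"
    using l by (intro char_density) (auto simp: xgamma_density_def)
  also have "\<dots> = (CLBINT x. (l\<^sup>2 / (1 + l)) *\<^sub>R (?f 0 x + (l / 2) *\<^sub>R ?f 2 x))"
    unfolding iexp_mult_exp[symmetric]
    by (intro Bochner_Integration.integral_cong refl)
      (auto simp: xgamma_density_def scaleR_conv_of_real algebra_simps split: split_indicator)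
  also have "\<dots> = (l\<^sup>2 / (1 + l)) *\<^sub>R ((CLBINT x. ?f 0 x) + (l / 2) *\<^sub>R (CLBINT x. ?f 2 x))"
    by (simp only: integral_scaleR_right Bochner_Integration.integral_add[OF int integrable_scaleR_right[OF int]])
  also have "\<dots> = (l\<^sup>2 / (1 + l)) *\<^sub>R (1 / ?z + l / ?z ^ 3)"
    unfolding integral_power_exp_complex[OF \<open>Re ?z > 0\<close>]
    by (simp add: scaleR_conv_of_real numeral_3_eq_3 fact_2)
  also have "1 / ?z + l / ?z ^ 3 = (?z\<^sup>2 + l) / ?z ^ 3"
    using \<open>?z \<noteq> 0\<close> by (simp add: add_divide_distrib power2_eq_square power3_eq_cube)
  finally show ?thesis
    by (simp add: w_def scaleR_conv_of_real)
qed

section \<open>Partial fractions in polynomial form\<close>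

text \<open>The difference of the two sides vanishes to order at least \<open>m\<close> at each of
  the distinct points \<open>a i\<close>, which amounts to at least \<open>m * card I\<close> roots
  with multiplicity. Its degree is smaller, so it is zero.\<close>

lemma partial_fractions_poly:
  fixes a :: "'i \<Rightarrow> 'a::field" and P :: "'a poly" and T :: "'i \<Rightarrow> 'a poly"
  assumes fin: "finite I" and inj: "inj_on a I"
    and deg_P: "degree P < m * card I" and deg_T: "\<And>i. i \<in> I \<Longrightarrow> degree (T i) < m"
    and dvd: "\<And>i. i \<in> I \<Longrightarrow>
      [:- a i, 1:] ^ m dvd P - T i * (\<Prod>j\<in>I - {i}. [:- a j, 1:] ^ m)"
  shows "P = (\<Sum>i\<in>I. T i * (\<Prod>j\<in>I - {i}. [:- a j, 1:] ^ m))"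
proof (rule ccontr)
  define Q where "Q i = (\<Prod>j\<in>I - {i}. [:- a j, 1:] ^ m)" for i
  define D where "D = P - (\<Sum>i\<in>I. T i * Q i)"
  assume "P \<noteq> (\<Sum>i\<in>I. T i * (\<Prod>j\<in>I - {i}. [:- a j, 1:] ^ m))"
  then have "D \<noteq> 0" by (simp add: D_def Q_def)
  have order: "m \<le> order (a i) D" if "i \<in> I" for i
  proof -
    \<comment> \<open>Every \<open>Q j\<close> with \<open>j\<close> different from \<open>i\<close>
      contains the factor belonging to \<open>a i\<close>, so only the \<open>i\<close>-th summand
      matters modulo its \<open>m\<close>-th power.\<close>
    have "D = (P - T i * Q i) - (\<Sum>j\<in>I - {i}. T j * Q j)"
      using that fin by (simp add: D_def sum.remove)
    moreover have "[:- a i, 1:] ^ m dvd Q j" if "j \<in> I - {i}" for j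
      unfolding Q_def using that \<open>i \<in> I\<close> fin by (intro dvd_prodI) auto
    ultimately have "[:- a i, 1:] ^ m dvd D"
      using dvd[OF that] by (auto simp: Q_def intro!: dvd_diff dvd_sum dvd_mult)
    then show ?thesis
      using \<open>D \<noteq> 0\<close> by (simp add: order_divides)
  qed
  have "m > 0" "card I > 0" using deg_P by (cases m; cases "card I"; simp)+
  have deg_Q: "degree (Q i) = m * card (I - {i})" for i
    unfolding Q_def by (subst degree_prod_eq_sum_degree) (auto simp: degree_power_eq)
  have "degree (T i * Q i) < m * card I" if "i \<in> I" for i
  proof -
    have "card I = Suc (card (I - {i}))"
      using that fin by (metis card_Suc_Diff1)
    then show ?thesis
      using degree_mult_le[of "T i" "Q i"] deg_Q[of i] deg_T[OF that] by simp
  qed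
  then have "degree D < m * card I"
    unfolding D_def using deg_P \<open>m > 0\<close> \<open>card I > 0\<close> by (intro degree_diff_less degree_sum_less) auto
  have "m * card I = (\<Sum>x\<in>a ` I. m)"
    using inj by (simp add: card_image)
  also have "\<dots> \<le> (\<Sum>x\<in>a ` I. order x D)"
    using order by (intro sum_mono) auto
  also have "\<dots> \<le> (\<Sum>x | poly D x = 0. order x D)"
  proof (rule sum_mono2)
    show "a ` I \<subseteq> {x. poly D x = 0}"
      using order \<open>m > 0\<close> \<open>D \<noteq> 0\<close> by (fastforce simp: order_root)
  qed (use \<open>D \<noteq> 0\<close> in \<open>auto intro: poly_roots_finite\<close>)
  also have "\<dots> \<le> degree D"
    by (rule sum_order_le_degree) fact
  finally show False using \<open>degree D < m * card I\<close> by simp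
qed

section \<open>Second-order Taylor data through logarithmic derivatives\<close>

text \<open>\<open>jet2 p c L M\<close> says \<open>p = c \<cdot> exp (L x + M x\<^sup>2 / 2)\<close> modulo \<open>x\<^sup>3\<close>: \<open>L\<close> and \<open>M\<close> are the first two
  logarithmic derivatives of \<open>p\<close> at \<open>0\<close>, and are therefore additive on products.\<close>

definition jet2 :: "'a::comm_ring_1 poly \<Rightarrow> 'a \<Rightarrow> 'a \<Rightarrow> 'a \<Rightarrow> bool" where
  "jet2 p c L M \<longleftrightarrow> coeff p 0 = c \<and> coeff p 1 = c * L \<and> 2 * coeff p 2 = c * (L\<^sup>2 + M)"

lemma jet2_1: "jet2 1 1 0 0"
  by (simp add: jet2_def)

lemma jet2_mult:
  assumes "jet2 p c L M" "jet2 q d L' M'"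
  shows "jet2 (p * q) (c * d) (L + L') (M + M')"
proof -
  have "2 * coeff (p * q) 2 =
      coeff p 0 * (2 * coeff q 2) + 2 * (coeff p 1 * coeff q 1) + 2 * coeff p 2 * coeff q 0"
    by (simp add: coeff_mult numeral_2_eq_2 algebra_simps)
  also have "\<dots> = c * d * ((L + L')\<^sup>2 + (M + M'))"
    using assms unfolding jet2_def by (simp only:) (simp add: power2_eq_square algebra_simps)
  finally show ?thesis
    using assms by (simp add: jet2_def coeff_mult algebra_simps)
qed

lemma jet2_prod:
  assumes "\<And>j. j \<in> J \<Longrightarrow> jet2 (p j) (c j) (L j) (M j)"
  shows "jet2 (\<Prod>j\<in>J. p j) (\<Prod>j\<in>J. c j) (\<Sum>j\<in>J. L j) (\<Sum>j\<in>J. M j)"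
  using assms
  by (induction J rule: infinite_finite_induct) (auto intro: jet2_1 jet2_mult)

text \<open>The jet fixes the coefficients of degree 0, 1 and 2; for the last one the factor 2 is
  cancelled in characteristic zero.\<close>

lemma jet2_unique:
  fixes p q :: "'a::field_char_0 poly"
  assumes "jet2 p c L M" "jet2 q c L M"
  shows "monom 1 3 dvd p - q"
proof -
  have "2 * coeff p 2 = 2 * coeff q 2" using assms by (simp add: jet2_def)
  then show ?thesis
    using assms by (auto simp: monom_1_dvd_iff' jet2_def less_Suc_eq eval_nat_numeral)
qed

text \<open>The polynomial is \<open>(x + d)^2 + w\<close>, a shifted numerator of the XGamma
  transform. The values are its first two logarithmic derivatives at 0, as they occur in the HypoXG
  coefficients.\<close>

lemma jet2_quadratic:
  fixes d w :: "'a::field_char_0"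
  assumes "d\<^sup>2 + w \<noteq> 0"
  shows "jet2 [:d\<^sup>2 + w, 2 * d, 1:] (d\<^sup>2 + w) (2 * d / (d\<^sup>2 + w)) (- 2 * ((d\<^sup>2 - w) / (d\<^sup>2 + w)\<^sup>2))"
proof -
  define c where "c = d\<^sup>2 + w"
  then have w: "w = c - d\<^sup>2" and "c \<noteq> 0" using assms by simp_all
  then show ?thesis
    unfolding w by (simp add: jet2_def numeral_2_eq_2 field_simps)
qed

lemma jet2_cube:
  fixes d :: "'a::field_char_0"
  assumes "d \<noteq> 0"
  shows "jet2 ([:d, 1:] ^ 3) (d ^ 3) (3 / d) (- (3 / d\<^sup>2))"
  using assms by (simp add: jet2_def numeral_2_eq_2 numeral_3_eq_3 field_simps)

section \<open>Principal parts and the HypoXG coefficients\<close>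

text \<open>Translating \<open>- w i\<close> to 0 turns the claim into a congruence modulo the cube
  of the variable, so comparing jets suffices. The three coefficients are exactly those of the jet
  with value \<open>hypoxg_A1\<close>, first logarithmic derivative \<open>?L\<close> and second
  \<open>?M\<close>, which is the jet of \<open>?P\<close> divided by that of
  \<open>?Q\<close>.\<close>

lemma hypoxg_principal_part:
  fixes n :: nat and \<theta> :: "nat \<Rightarrow> real"
  defines "w \<equiv> \<lambda>j. complex_of_real (\<theta> j)"
  assumes pos: "\<And>i. i \<in> {1..n} \<Longrightarrow> \<theta> i > 0" and inj: "inj_on \<theta> {1..n}" and i: "i \<in> {1..n}"
  shows "[:w i, 1:] ^ 3 dvd (\<Prod>j=1..n. [:(w j)\<^sup>2 + w j, 2 * w j, 1:]) -
    [:of_real (hypoxg_A1 n \<theta> i), of_real (hypoxg_A2 n \<theta> i), of_real (hypoxg_A3 n \<theta> i):] \<circ>\<^sub>p [:w i, 1:] *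
    (\<Prod>j\<in>{1..n} - {i}. [:w j, 1:] ^ 3)"
    (is "_ dvd ?P - ?T \<circ>\<^sub>p _ * ?Q")
proof -
  let ?J = "{1..n} - {i}"
  let ?d = "\<lambda>j. w j - w i"
  let ?s = "[:- w i, 1:]"
  let ?l = "\<lambda>j. 2 * ?d j / ((?d j)\<^sup>2 + w j)"
  let ?m = "\<lambda>j. - 2 * (((?d j)\<^sup>2 - w j) / ((?d j)\<^sup>2 + w j)\<^sup>2)"
  let ?L = "\<Sum>j\<in>?J. ?l j - 3 / ?d j"
  let ?M = "2 / w i + (\<Sum>j\<in>?J. ?m j + 3 / (?d j)\<^sup>2)"
  have d: "?d j \<noteq> 0" if "j \<in> ?J" for j
    using that i by (simp add: w_def inj_on_eq_iff[OF inj])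
  have d2: "(?d j)\<^sup>2 + w j \<noteq> 0" if "j \<in> ?J" for j
  proof -
    have "(\<theta> j - \<theta> i)\<^sup>2 + \<theta> j > 0"
      using that pos[of j] by (intro add_nonneg_pos) auto
    moreover have "(?d j)\<^sup>2 + w j = of_real ((\<theta> j - \<theta> i)\<^sup>2 + \<theta> j)"
      by (simp add: w_def)
    ultimately show ?thesis
      by (metis less_irrefl of_real_eq_0_iff)
  qed
  have wi: "w i \<noteq> 0" using pos[OF i] by (simp add: w_def)
  have "?P \<circ>\<^sub>p ?s = (\<Prod>j=1..n. [:(?d j)\<^sup>2 + w j, 2 * ?d j, 1:])"
    unfolding pcompose_prod
    by (intro prod.cong refl) (simp add: pcompose_pCons power2_eq_square algebra_simps)
  also have "\<dots> = [:w i, 0, 1:] * (\<Prod>j\<in>?J. [:(?d j)\<^sup>2 + w j, 2 * ?d j, 1:])"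
    using i by (subst prod.remove[of _ i]) auto
  finally have P: "?P \<circ>\<^sub>p ?s = \<dots>" .
  \<comment> \<open>The factor with \<open>j = i\<close> has no linear term after translation. It is
    the source of the leading \<open>\<theta> i\<close> in \<open>hypoxg_A1\<close> and of the
    summand \<open>2 / \<theta> i\<close> in \<open>hypoxg_A3\<close>.\<close>
  have "jet2 [:w i, 0, 1:] (w i) 0 (2 / w i)"
    using wi by (simp add: jet2_def numeral_2_eq_2)
  from jet2_mult[OF this jet2_prod[OF jet2_quadratic[OF d2]]]
  have jet_P: "jet2 (?P \<circ>\<^sub>p ?s) (w i * (\<Prod>j\<in>?J. (?d j)\<^sup>2 + w j))
      (0 + (\<Sum>j\<in>?J. ?l j)) (2 / w i + (\<Sum>j\<in>?J. ?m j))"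
    unfolding P .
  have Q: "?Q \<circ>\<^sub>p ?s = (\<Prod>j\<in>?J. [:?d j, 1:] ^ 3)"
    unfolding pcompose_prod
    by (intro prod.cong refl) (simp only: pcompose_mult power3_eq_cube, simp add: pcompose_pCons)
  have jet_Q: "jet2 (?Q \<circ>\<^sub>p ?s) (\<Prod>j\<in>?J. ?d j ^ 3) (\<Sum>j\<in>?J. 3 / ?d j) (\<Sum>j\<in>?J. - (3 / (?d j)\<^sup>2))"
    unfolding Q by (intro jet2_prod jet2_cube d)
  have A1: "complex_of_real (hypoxg_A1 n \<theta> i) = w i * (\<Prod>j\<in>?J. ((?d j)\<^sup>2 + w j) / ?d j ^ 3)"
    by (simp add: hypoxg_A1_def w_def)
  have A2: "complex_of_real (hypoxg_A2 n \<theta> i) = hypoxg_A1 n \<theta> i * ?L"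
    by (simp add: hypoxg_A2_def w_def)
  have A3: "complex_of_real (hypoxg_A3 n \<theta> i) =
      hypoxg_A1 n \<theta> i / 2 * ?L\<^sup>2 + hypoxg_A1 n \<theta> i / 2 * ?M"
    unfolding hypoxg_A3_def by (simp add: w_def)
  have "jet2 ?T (hypoxg_A1 n \<theta> i) ?L ?M"
    unfolding jet2_def A2 A3 by (simp add: numeral_2_eq_2 distrib_left)
  note jet_T = jet2_mult[OF this jet_Q]
  have "complex_of_real (hypoxg_A1 n \<theta> i) * (\<Prod>j\<in>?J. ?d j ^ 3) = w i * (\<Prod>j\<in>?J. (?d j)\<^sup>2 + w j)"
    using d by (simp add: A1 prod_dividef)
  moreover have "?L + (\<Sum>j\<in>?J. 3 / ?d j) = 0 + (\<Sum>j\<in>?J. ?l j)"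
    by (simp add: sum_subtractf)
  moreover have "?M + (\<Sum>j\<in>?J. - (3 / (?d j)\<^sup>2)) = 2 / w i + (\<Sum>j\<in>?J. ?m j)"
    by (simp only: add.assoc flip: sum.distrib) simp
  ultimately have "jet2 (?T * (?Q \<circ>\<^sub>p ?s)) (w i * (\<Prod>j\<in>?J. (?d j)\<^sup>2 + w j))
      (0 + (\<Sum>j\<in>?J. ?l j)) (2 / w i + (\<Sum>j\<in>?J. ?m j))"
    using jet_T by (simp only:)
  from jet2_unique[OF jet_P this]
  obtain R where R: "?P \<circ>\<^sub>p ?s - ?T * (?Q \<circ>\<^sub>p ?s) = monom 1 3 * R" ..
  \<comment> \<open>Composing with the inverse translation carries the congruence back to the
    original variable.\<close>
  have inv: "q \<circ>\<^sub>p ?s \<circ>\<^sub>p [:w i, 1:] = q" for q :: "complex poly"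
    by (simp add: pcompose_pCons flip: pcompose_assoc)
  have "monom 1 3 \<circ>\<^sub>p [:w i, 1:] = [:w i, 1:] ^ 3"
    by (simp add: monom_altdef power3_eq_cube pcompose_mult pcompose_pCons)
  then have "?P - ?T \<circ>\<^sub>p [:w i, 1:] * ?Q = [:w i, 1:] ^ 3 * (R \<circ>\<^sub>p [:w i, 1:])"
    using arg_cong[OF R, of "\<lambda>q. q \<circ>\<^sub>p [:w i, 1:]"]
    by (simp only: pcompose_diff pcompose_mult inv)
  then show ?thesis by simp
qed

lemma hypoxg_partial_fractions:
  fixes z :: complex
  assumes pos: "\<And>i. i \<in> {1..n} \<Longrightarrow> \<theta> i > 0" and inj: "inj_on \<theta> {1..n}"
    and z: "\<And>i. i \<in> {1..n} \<Longrightarrow> z + \<theta> i \<noteq> 0" and n: "n \<ge> 1"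
  shows "(\<Prod>j=1..n. ((z + \<theta> j)\<^sup>2 + \<theta> j) / (z + \<theta> j) ^ 3) =
    (\<Sum>i=1..n. \<Sum>k=1..3. hypoxg_A n \<theta> i k / (z + \<theta> i) ^ (4 - k))"
proof -
  define w where "w j = complex_of_real (\<theta> j)" for j
  define P where "P = (\<Prod>j=1..n. [:(w j)\<^sup>2 + w j, 2 * w j, 1:])"
  define Q where "Q i = (\<Prod>j\<in>{1..n}-{i}. [:w j, 1:] ^ 3)" for i
  define T where "T i = [:complex_of_real (hypoxg_A1 n \<theta> i), of_real (hypoxg_A2 n \<theta> i),
    of_real (hypoxg_A3 n \<theta> i):] \<circ>\<^sub>p [:w i, 1:]" for i
  have P: "P = (\<Sum>i\<in>{1..n}. T i * Q i)"
    unfolding Q_def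
  proof (rule partial_fractions_poly[where a = "\<lambda>j. - w j", unfolded minus_minus])
    \<comment> \<open>The numerator has degree \<open>2 * n\<close> and the common denominator
      degree \<open>3 * n\<close>; \<open>n \<ge> 1\<close> makes the inequality strict.\<close>
    have "degree P = 2 * n"
      unfolding P_def by (subst degree_prod_eq_sum_degree) auto
    then show "degree P < 3 * card {1..n}" using n by simp
    show "inj_on (\<lambda>j. - w j) {1..n}"
      by (rule inj_onI) (simp add: w_def inj_on_eq_iff[OF inj])
    show "[:w i, 1:] ^ 3 dvd P - T i * (\<Prod>j\<in>{1..n} - {i}. [:w j, 1:] ^ 3)" if "i \<in> {1..n}" for i
      using hypoxg_principal_part[OF pos inj that] unfolding P_def T_def w_def .
  qed (auto simp: T_def degree_pcompose degree_pCons_eq_if)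
  have z': "z + w j \<noteq> 0" if "j \<in> {1..n}" for j using z[OF that] by (simp add: w_def)
  let ?N = "\<Prod>j=1..n. (z + w j) ^ 3"
  have "poly P z = (\<Prod>j=1..n. (z + w j)\<^sup>2 + w j)"
    by (simp add: P_def poly_prod power2_eq_square algebra_simps)
  then have "(\<Prod>j=1..n. ((z + w j)\<^sup>2 + w j) / (z + w j) ^ 3) = poly P z / ?N"
    by (simp add: prod_dividef)
  also have "\<dots> = (\<Sum>i=1..n. poly (T i) z * poly (Q i) z / ?N)"
    unfolding P by (simp add: poly_sum sum_divide_distrib)
  also have "\<dots> = (\<Sum>i=1..n. \<Sum>k=1..3. hypoxg_A n \<theta> i k / (z + w i) ^ (4 - k))"
  proof (rule sum.cong[OF refl])
    fix i assume i: "i \<in> {1..n}"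
    have Q: "poly (Q i) z = (\<Prod>j\<in>{1..n}-{i}. (z + w j) ^ 3)"
      by (simp add: Q_def poly_prod add.commute)
    then have N: "?N = (z + w i) ^ 3 * poly (Q i) z"
      using i by (simp add: prod.remove)
    have "poly (Q i) z \<noteq> 0"
      using z' by (simp add: Q)
    then have "poly (T i) z * poly (Q i) z / ?N = poly (T i) z / (z + w i) ^ 3"
      unfolding N by simp
    \<comment> \<open>\<open>T i\<close> is expanded in powers of \<open>z + w i\<close>, so
      division by the cube reverses the exponents and the coefficient with index \<open>k\<close>
      lands over the power \<open>4 - k\<close>.\<close>
    also have "\<dots> = hypoxg_A1 n \<theta> i / (z + w i) ^ 3 + hypoxg_A2 n \<theta> i / (z + w i) ^ 2
        + hypoxg_A3 n \<theta> i / (z + w i)"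
      using z'[OF i]
      by (simp add: T_def poly_pcompose add.commute[of "w i"] add_divide_distrib power2_eq_square power3_eq_cube)
    also have "\<dots> = (\<Sum>k=1..3. hypoxg_A n \<theta> i k / (z + w i) ^ (4 - k))"
      by (simp add: hypoxg_A_def numeral_3_eq_3 numeral_2_eq_2)
    finally show "poly (T i) z * poly (Q i) z / ?N = \<dots>" .
  qed
  finally show ?thesis by (simp add: w_def)
qed

section \<open>From characteristic functions to reliability functions\<close>

lemma distributed_imp_distr_borel:
  assumes "distributed M lborel X f"
  shows "distr M borel X = density lborel f"
proof -
  have "distr M borel X = distr M lborel X"
    by (intro distr_cong) auto
  then show ?thesis
    using distributed_distr_eq_density[OF assms] by simp
qed

text \<open>Independence makes the characteristic function a product of XGamma factors. Its partial
  fraction expansion at \<open>z = -it\<close> has poles only at points with negative real part, so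
  evaluation on the imaginary axis is safe.\<close>

lemma char_hypoxg:
  assumes n: "n \<ge> 1" and pos: "\<And>i. i \<in> {1..n} \<Longrightarrow> \<theta> i > 0" and inj: "inj_on \<theta> {1..n}"
    and S: "hypoxg_rv M n \<theta> S"
  shows "char (distr M borel S) t = (\<Sum>i=1..n. \<Sum>k=1..3.
    hypoxg_R n \<theta> i k * (complex_of_real (\<theta> i) ^ (4 - k) / (\<theta> i - \<i> * t) ^ (4 - k)))"
proof -
  let ?z = "- \<i> * complex_of_real t"
  let ?C = "\<Prod>l=1..n. (\<theta> l)\<^sup>2 / (1 + \<theta> l)"
  interpret prob_space M using S by (simp add: hypoxg_rv_def)
  obtain X where indep: "indep_vars (\<lambda>_. borel) X {1..n}"
    and X: "\<And>j. j \<in> {1..n} \<Longrightarrow> xgamma_rv M (\<theta> j) (X j)"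
    and sum: "\<And>\<omega>. \<omega> \<in> space M \<Longrightarrow> S \<omega> = (\<Sum>j=1..n. X j \<omega>)"
    using S by (auto simp: hypoxg_rv_def)
  have "distr M borel S = distr M borel (\<lambda>\<omega>. \<Sum>j=1..n. X j \<omega>)"
    using sum by (intro distr_cong) auto
  then have "char (distr M borel S) t = (\<Prod>j=1..n. char (distr M borel (X j)) t)"
    using char_distr_sum[OF indep] by simp
  also have "\<dots> = (\<Prod>j=1..n. complex_of_real ((\<theta> j)\<^sup>2 / (1 + \<theta> j)) *
      (((?z + \<theta> j)\<^sup>2 + \<theta> j) / (?z + \<theta> j) ^ 3))"
  proof (rule prod.cong[OF refl])
    fix j assume j: "j \<in> {1..n}"
    have "distr M borel (X j) = density lborel (\<lambda>x. ennreal (xgamma_density (\<theta> j) x))"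
      using X[OF j] by (intro distributed_imp_distr_borel) (simp add: xgamma_rv_def)
    then show "char (distr M borel (X j)) t = complex_of_real ((\<theta> j)\<^sup>2 / (1 + \<theta> j)) *
      (((?z + \<theta> j)\<^sup>2 + \<theta> j) / (?z + \<theta> j) ^ 3)"
      using char_xgamma_density[OF pos[OF j]] by simp
  qed
  also have "\<dots> = complex_of_real ?C * (\<Prod>j=1..n. ((?z + \<theta> j)\<^sup>2 + \<theta> j) / (?z + \<theta> j) ^ 3)"
    by (simp only: prod.distrib of_real_prod)
  also have "(\<Prod>j=1..n. ((?z + \<theta> j)\<^sup>2 + \<theta> j) / (?z + \<theta> j) ^ 3) =
      (\<Sum>i=1..n. \<Sum>k=1..3. hypoxg_A n \<theta> i k / (?z + \<theta> i) ^ (4 - k))"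
  proof (rule hypoxg_partial_fractions[OF pos inj _ n])
    show "?z + \<theta> i \<noteq> 0" if "i \<in> {1..n}" for i
      using pos[OF that] by (simp add: complex_eq_iff)
  qed
  also have "complex_of_real ?C * \<dots> = (\<Sum>i=1..n. \<Sum>k=1..3.
    hypoxg_R n \<theta> i k * (complex_of_real (\<theta> i) ^ (4 - k) / (\<theta> i - \<i> * t) ^ (4 - k)))"
    unfolding sum_distrib_left
  proof (intro sum.cong refl)
    fix i k assume "i \<in> {1..n}"
    then have "complex_of_real (\<theta> i) \<noteq> 0" using pos[of i] by simp
    \<comment> \<open>The division by \<open>\<theta> i ^ (4 - k)\<close> in \<open>hypoxg_R\<close>
      compensates the numerator of the Erlang characteristic function.\<close>
    then have "complex_of_real (hypoxg_R n \<theta> i k) * complex_of_real (\<theta> i) ^ (4 - k)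
        = complex_of_real ?C * hypoxg_A n \<theta> i k"
      by (simp add: hypoxg_R_def)
    then show "complex_of_real ?C * (hypoxg_A n \<theta> i k / (?z + \<theta> i) ^ (4 - k)) =
        hypoxg_R n \<theta> i k * (complex_of_real (\<theta> i) ^ (4 - k) / (\<theta> i - \<i> * t) ^ (4 - k))"
      by (simp add: add.commute)
  qed
  finally show ?thesis .
qed

theorem theorem2p5:
  fixes n :: nat and \<theta> :: "nat \<Rightarrow> real"
    and M :: "'a measure" and S :: "'a \<Rightarrow> real"
    and N :: "nat \<Rightarrow> nat \<Rightarrow> 'b measure" and Y :: "nat \<Rightarrow> nat \<Rightarrow> 'b \<Rightarrow> real"
    and t :: real
  assumes "n \<ge> 1"
    and "\<And>i. i \<in> {1..n} \<Longrightarrow> \<theta> i > 0"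
    and "inj_on \<theta> {1..n}"
    and "hypoxg_rv M n \<theta> S"
    and "\<And>i k. i \<in> {1..n} \<Longrightarrow> k \<in> {1..3} \<Longrightarrow> erlang_rv (N i k) (4 - k) (\<theta> i) (Y i k)"
  shows "reliability M S t =
    (\<Sum>i=1..n. \<Sum>k=1..3. hypoxg_R n \<theta> i k * reliability (N i k) (Y i k) t)"
proof -
  define N' where "N' i k = distr (N i k) borel (Y i k)" for i k
  let ?I = "{1..n} \<times> {1..3}"
  have Y: "real_distribution (N' i k)"
    "char (N' i k) u = complex_of_real (\<theta> i) ^ (4 - k) / (\<theta> i - \<i> * u) ^ (4 - k)"
    if "i \<in> {1..n}" "k \<in> {1..3}" for i k u
  proof -
    have erl: "prob_space (N i k)"
      and D: "distributed (N i k) lborel (Y i k) (\<lambda>t. ennreal (erlang_density (4 - k - 1) (\<theta> i) t))"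
      using assms(5)[OF that] by (auto simp: erlang_rv_def)
    have "Y i k \<in> borel_measurable (N i k)"
      using distributed_measurable[OF D] by simp
    then show "real_distribution (N' i k)"
      unfolding N'_def using erl by (intro prob_space.real_distribution_distr) auto
    \<comment> \<open>Truncated subtraction is exact here because \<open>k\<close> is at most 3; the
      successor undoes the shift in the shape parameter of \<open>erlang_density\<close>.\<close>
    have "Suc (4 - k - 1) = 4 - k" using that by auto
    then show "char (N' i k) u = complex_of_real (\<theta> i) ^ (4 - k) / (\<theta> i - \<i> * u) ^ (4 - k)"
      unfolding N'_def distributed_imp_distr_borel[OF D]
      using char_erlang_density[OF assms(2)[OF that(1)], of "4 - k - 1" u] by simp
  qed
  have S: "real_distribution (distr M borel S)"
  proof -
    interpret prob_space M using assms(4) by (simp add: hypoxg_rv_def)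
    obtain X where "indep_vars (\<lambda>_. borel) X {1..n}"
      and "\<And>\<omega>. \<omega> \<in> space M \<Longrightarrow> S \<omega> = (\<Sum>j=1..n. X j \<omega>)"
      using assms(4) by (auto simp: hypoxg_rv_def)
    then have "S \<in> borel_measurable M"
      by (subst measurable_cong[of M S]) (auto simp: indep_vars_def intro!: borel_measurable_sum)
    then show ?thesis by (rule real_distribution_distr)
  qed
  have char_S: "char (distr M borel S) u =
      (\<Sum>(i, k)\<in>?I. hypoxg_R n \<theta> i k * char (N' i k) u)" for u
  proof -
    have "char (distr M borel S) u = (\<Sum>i=1..n. \<Sum>k=1..3. hypoxg_R n \<theta> i k * char (N' i k) u)"
      using char_hypoxg[OF assms(1-4), of u] Y(2) by simp
    then show ?thesis by (simp only: sum.cartesian_product)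
  qed
  have "real_distribution (case p of (i, k) \<Rightarrow> N' i k)" if "p \<in> ?I" for p
    using that Y(1) by auto
  from cdf_signed_mixture[OF _ S this, where c = "\<lambda>(i, k). hypoxg_R n \<theta> i k" and x = t]
  have cdf_S: "cdf (distr M borel S) t = (\<Sum>(i, k)\<in>?I. hypoxg_R n \<theta> i k * cdf (N' i k) t)"
    using char_S by (simp add: case_prod_unfold)
  \<comment> \<open>Every characteristic function is 1 at 0, so the coefficients sum to 1. This is
    what carries the identity from distribution functions to their complements.\<close>
  have "1 = (\<Sum>(i, k)\<in>?I. hypoxg_R n \<theta> i k * char (N' i k) 0)"
    using char_S[of 0] real_distribution.char_zero[OF S] by simp
  also have "\<dots> = (\<Sum>(i, k)\<in>?I. complex_of_real (hypoxg_R n \<theta> i k))"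
    using real_distribution.char_zero[OF Y(1)] by (intro sum.cong refl) auto
  also have "\<dots> = complex_of_real (\<Sum>(i, k)\<in>?I. hypoxg_R n \<theta> i k)"
    by (simp add: case_prod_unfold)
  finally have "(\<Sum>(i, k)\<in>?I. hypoxg_R n \<theta> i k) = 1"
    by (metis of_real_eq_1_iff)
  then show ?thesis
    unfolding reliability_def cdf_S sum.cartesian_product
    by (simp add: N'_def right_diff_distrib sum_subtractf case_prod_unfold)
qed

end
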